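(* Consider a normalized Hamburger moment problem with recurrence coefficients $a_n\in\mathbb R$, $b_n>0$. Assume that $$\sum_{n=1}^\infty\frac{1+|a_n|}{\sqrt{b_nb_{n-1}}}<\infty,$$ and that there is $n_0\ge1$ such that either $b_n^2\le b_{n-1}b_{n+1}$ for all $n\ge n_0$, or $b_n^2\ge b_{n-1}b_{n+1}$ for all $n\ge n_0$. Assume further that the moment problem has order $0$. Then the logarithmic order $\rho^{[1]}$ of the moment problem is given as $\rho^{[1]}=\mathcal E(\log b_n)$.
   Context: A normalized Hamburger moment problem is given by a sequence $s_n=\int_{-\infty}^\infty x^n\,d\mu(x)$, $n\ge0$, where $\mu$ is a probability measure on $\mathbb R$ with infinite support and moments of every order. Its orthonormal polynomials $P_n$ satisfy $zP_n(z)=b_nP_{n+1}(z)+a_nP_n(z)+b_{n-1}P_{n-1}(z)$, $n\ge0$, with $a_n\in\mathbb R$, $b_n>0$ for $n\ge 0$, $b_{-1}=1$, $P_0=1$, $P_{-1}=0$. Put $P(z)=(\sum_{n\ge0}|P_n(z)|^2)^{1/2}$, which is finite and continuous on $\mathbb C$ when the moment problem is indeterminate (more than one measure with the given moments). The summability and log-convexity/log-concavity hypotheses of the claim are known to imply indeterminacy and that $b_n\to\infty$. For an unbounded continuous $f:\mathbb C\to\mathbb C$ let $M_f(r)=\max_{|z|\le r}|f(z)|$. The order is $\rho_f=\inf\{a>0\mid \log M_f(r)\le r^a\text{ for all large }r\}$ and the logarithmic order is $\rho^{[1]}_f=\inf\{a>0\mid M_f(r)\le r^{(\log r)^a}\text{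 for all large }r\}\in[0,\infty]$ ($\inf\emptyset=\infty$). The order, and for order zero the logarithmic order $\rho^{[1]}$, of an indeterminate moment problem are those of $P$ (it is known that $(\sum_n|Q_n(z)|^2)^{1/2}$, with $Q_n$ the polynomials of the second kind, and the four entire Nevanlinna functions $A,B,C,D$ give the same values). For a sequence $(z_n)$ with $|z_n|\to\infty$ (defined for sufficiently large $n$) the exponent of convergence is $\mathcal E(z_n)=\inf\{a>0\mid\sum_{n\ge n^*}|z_n|^{-a}<\infty\}$ ($\inf\emptyset=\infty$), where $n^*$ is such that $|z_n|>0$ for $n\ge n^*$. *)

theory Defs
  imports "HOL-Probability.Probability" "HOL-Computational_Algebra.Polynomial"
begin

definition measure_support :: "real measure \<Rightarrow> real set" where
  "measure_support \<mu> = {x. \<forall>\<epsilon>>0. emeasure \<mu> (ball x \<epsilon>) > 0}"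

definition solves_moment_problem :: "(nat \<Rightarrow> real) \<Rightarrow> real measure \<Rightarrow> bool" where
  "solves_moment_problem s \<mu> \<longleftrightarrow>
     prob_space \<mu> \<and> sets \<mu> = sets borel \<and> infinite (measure_support \<mu>) \<and>
     (\<forall>n. integrable \<mu> (\<lambda>x. x ^ n) \<and> s n = (LINT x|\<mu>. x ^ n))"

text \<open>The normalisation (degree \<open>n\<close>, positive leading coefficient) makes the sequence unique, and
  it depends on the measure only through its moments.\<close>

definition orthonormal_polynomials :: "real measure \<Rightarrow> (nat \<Rightarrow> real poly) \<Rightarrow> bool" where
  "orthonormal_polynomials \<mu> P \<longleftrightarrow>
     (\<forall>n. degree (P n) = n \<and> lead_coeff (P n) > 0) \<and>
     (\<forall>m n. (LINT x|\<mu>. poly (P m) x * poly (P n) x) = (if m = n then 1 else 0))"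

text \<open>The case \<open>n = 0\<close> reflects the convention \<open>P\<^sub>-\<^sub>1 = 0\<close>.\<close>

definition recurrence_coefficients ::
    "(nat \<Rightarrow> real poly) \<Rightarrow> (nat \<Rightarrow> real) \<Rightarrow> (nat \<Rightarrow> real) \<Rightarrow> bool" where
  "recurrence_coefficients P a b \<longleftrightarrow>
     P 0 = 1 \<and> (\<forall>n. b n > 0) \<and>
     (\<forall>n. [:0, 1:] * P n = smult (b n) (P (n + 1)) + smult (a n) (P n) +
        (if n = 0 then 0 else smult (b (n - 1)) (P (n - 1))))"

text \<open>The function \<open>P(z)\<close> whose growth defines the order of the moment problem; the series
  converges everywhere when the moment problem is indeterminate.\<close>

definition moment_function :: "(nat \<Rightarrow> real poly) \<Rightarrow> complex \<Rightarrow> real" where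
  "moment_function P z =
     sqrt (\<Sum>n. (norm (poly (map_poly complex_of_real (P n)) z))\<^sup>2)"

text \<open>For continuous \<open>f\<close> and \<open>r \<ge> 0\<close> the supremum is a maximum.\<close>

definition max_modulus :: "(complex \<Rightarrow> 'a::real_normed_vector) \<Rightarrow> real \<Rightarrow> real" where
  "max_modulus f r = (SUP z\<in>cball 0 r. norm (f z))"

text \<open>The infima below are taken in the extended reals, where the infimum of the empty set
  is \<open>\<infinity>\<close>.\<close>

definition growth_order :: "(complex \<Rightarrow> 'a::real_normed_vector) \<Rightarrow> ereal" where
  "growth_order f =
     Inf {ereal \<alpha> | \<alpha>. \<alpha> > 0 \<and> (\<forall>\<^sub>F r in at_top. ln (max_modulus f r) \<le> r powr \<alpha>)}"

definition logarithmic_order :: "(complex \<Rightarrow> 'a::real_normed_vector) \<Rightarrow> ereal" where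
  "logarithmic_order f =
     Inf {ereal \<alpha> | \<alpha>. \<alpha> > 0 \<and> (\<forall>\<^sub>F r in at_top. max_modulus f r \<le> r powr (ln r powr \<alpha>))}"

text \<open>For \<open>|z\<^sub>n| \<rightarrow> \<infinity>\<close> an index \<open>N\<close> as below exists, and summability does not depend on its
  choice.\<close>

definition exponent_of_convergence :: "(nat \<Rightarrow> 'a::real_normed_vector) \<Rightarrow> ereal" where
  "exponent_of_convergence z =
     Inf {ereal \<alpha> | \<alpha>. \<alpha> > 0 \<and>
       (\<exists>N. (\<forall>n\<ge>N. norm (z n) > 0) \<and> summable (\<lambda>n. norm (z (n + N)) powr - \<alpha>))}"

end

theory Submission
  imports Defs "HOL-Complex_Analysis.Cauchy_Integral_Formula" "HOL-Real_Asymp.Real_Asymp"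
begin

text \<open>
  Under the shape hypothesis the ratios \<open>b\<^sub>n\<^sub>+\<^sub>1 / b\<^sub>n\<close> are eventually monotone, so summability
  forces \<open>b\<^sub>n\<close> to increase to \<open>\<infinity>\<close>. Rescaling \<open>\<bar>P\<^sub>n(z)\<bar>\<close> by \<open>sqrt b\<^sub>n\<^sub>-\<^sub>1\<close> (log-convex case) or
  \<open>sqrt b\<^sub>n\<close> (log-concave case) turns the three-term recurrence into
  \<open>v\<^sub>n\<^sub>+\<^sub>1 \<le> c\<^sub>n v\<^sub>n + v\<^sub>n\<^sub>-\<^sub>1\<close> with \<open>c\<^sub>n = (\<bar>z\<bar> + \<bar>a\<^sub>n\<bar>) / sqrt (b\<^sub>n b\<^sub>n\<^sub>-\<^sub>1)\<close>, whence
  \<open>P(z) \<le> A (1 + \<bar>z\<bar>)\<^sup>d \<Prod>\<^sub>n (1 + \<bar>z\<bar> / b\<^sub>n)\<close>. Conversely Cauchy's estimate for the leading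
  coefficient \<open>1 / (b\<^sub>0 \<dots> b\<^sub>n\<^sub>-\<^sub>1)\<close> of \<open>P\<^sub>n\<close> gives \<open>r\<^sup>n \<le> M\<^sub>P(r) b\<^sub>0 \<dots> b\<^sub>n\<^sub>-\<^sub>1\<close>, and the choice
  \<open>r = b\<^sub>n\<^sup>2\<close> turns \<open>M\<^sub>P(r) \<le> r powr ((ln r) powr \<alpha>)\<close> into \<open>n = O((ln b\<^sub>n) powr \<alpha>)\<close>.
\<close>

subsection \<open>Upper bound\<close>

text \<open>Log-convexity carries an ascent \<open>b n \<le> b (Suc n)\<close> forward,
  log-concavity carries a strict descent forward. A non-increasing tail would keep \<open>b\<close>
  bounded and contradict \<open>lim\<close>, so in the first case an ascent must occur and in the
  second no descent can.\<close>

lemma eventually_increasing: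
  fixes b :: "nat \<Rightarrow> real"
  assumes pos: "\<And>n. b n > 0"
    and shape: "(\<forall>n\<ge>n\<^sub>0. (b n)\<^sup>2 \<le> b (n - 1) * b (n + 1)) \<or>
                (\<forall>n\<ge>n\<^sub>0. (b n)\<^sup>2 \<ge> b (n - 1) * b (n + 1))"
    and lim: "(\<lambda>n. 1 / sqrt (b (n + 1) * b n)) \<longlonglongrightarrow> 0"
  obtains m where "m \<ge> n\<^sub>0" "\<And>n. n \<ge> m \<Longrightarrow> b n \<le> b (Suc n)"
proof -
  have not_decreasing: False if dec: "\<And>n. n \<ge> m \<Longrightarrow> b (Suc n) \<le> b n" for m
  proof -
    have le: "b (m + k) \<le> b m" for k
    proof (induction k)
      case (Suc k)
      then show ?case using dec[of "m + k"] by simp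
    qed simp
    have "1 / b m \<le> 1 / sqrt (b (n + 1) * b n)" if "n \<ge> m" for n
    proof -
      have "b n \<le> b m" "b (n + 1) \<le> b m"
        using le[of "n - m"] le[of "n + 1 - m"] that by auto
      then have "sqrt (b (n + 1) * b n) \<le> sqrt (b m * b m)"
        using pos by (intro real_sqrt_le_mono mult_mono) (auto intro: less_imp_le)
      also have "\<dots> = b m" using pos[of m] by simp
      finally show ?thesis
        using pos by (intro divide_left_mono) auto
    qed
    then have "1 / b m \<le> 0"
      by (intro LIMSEQ_le_const[OF lim]) auto
    then show False using pos[of m] by simp
  qed
  from shape show ?thesis
  proof
    assume cvx: "\<forall>n\<ge>n\<^sub>0. (b n)\<^sup>2 \<le> b (n - 1) * b (n + 1)"
    obtain m where m: "m \<ge> n\<^sub>0" "b m \<le> b (Suc m)"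
      using not_decreasing[of n\<^sub>0] by (meson linear)
    have "b n \<le> b (Suc n)" if "n \<ge> m" for n
      using that
    proof (induction n rule: dec_induct)
      case base
      then show ?case by (rule m(2))
    next
      case (step n)
      have "b (Suc n) * b (Suc n) \<le> b n * b (Suc (Suc n))"
        using cvx[rule_format, of "Suc n"] m(1) step.hyps by (auto simp: power2_eq_square)
      also have "\<dots> \<le> b (Suc n) * b (Suc (Suc n))"
        using step.IH pos by (intro mult_right_mono) (auto intro: less_imp_le)
      finally show ?case using pos[of "Suc n"] by simp
    qed
    then show ?thesis using m(1) that by blast
  next
    assume ccv: "\<forall>n\<ge>n\<^sub>0. (b n)\<^sup>2 \<ge> b (n - 1) * b (n + 1)"
    have "b n \<le> b (Suc n)" if n: "n \<ge> n\<^sub>0" for n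
    proof (rule ccontr)
      assume "\<not> b n \<le> b (Suc n)"
      then have less: "b (Suc n) < b n" by simp
      have "b (Suc k) < b k" if "k \<ge> n" for k
        using that
      proof (induction k rule: dec_induct)
        case base
        then show ?case by (rule less)
      next
        case (step k)
        have "b (Suc k) * b (Suc (Suc k)) < b k * b (Suc (Suc k))"
          using step.IH pos by (intro mult_strict_right_mono) auto
        also have "\<dots> \<le> b (Suc k) * b (Suc k)"
          using ccv[rule_format, of "Suc k"] n step.hyps by (auto simp: power2_eq_square)
        finally show ?case using pos[of "Suc k"] by simp
      qed
      then show False using not_decreasing[of n] by (meson less_imp_le)
    qed
    then show ?thesis using that[of n\<^sub>0] by simp
  qed
qed

text \<open>If \<open>v n\<close> and \<open>v (Suc n)\<close> are both at most some
  \<open>B \<ge> 0\<close>, then the next value is at most \<open>(1 + c n) * B\<close>. The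
  induction step needs two consecutive values, hence the simultaneous proof.\<close>

lemma two_step_recurrence_bound:
  fixes v c :: "nat \<Rightarrow> real"
  assumes "\<And>n. v n \<ge> 0" and c: "\<And>n. c n \<ge> 0"
    and rec: "\<And>n. v (Suc (Suc n)) \<le> c n * v (Suc n) + v n"
  shows "v n \<le> max (v 0) (v 1) * (\<Prod>k<n. 1 + c k)"
    and "v (Suc n) \<le> max (v 0) (v 1) * (\<Prod>k<n. 1 + c k)"
proof (induction n)
  case 0
  { case 1 show ?case by simp next case 2 show ?case by simp }
next
  case (Suc n)
  let ?B = "max (v 0) (v 1) * (\<Prod>k<n. 1 + c k)"
  have B: "max (v 0) (v 1) * (\<Prod>k<Suc n. 1 + c k) = ?B + c n * ?B"
    by (simp add: algebra_simps)
  have nonneg: "?B \<ge> 0"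
    using assms(1)[of n] Suc.IH(1) by linarith
  {
    case 1
    have "0 \<le> c n * ?B" by (rule mult_nonneg_nonneg[OF c nonneg])
    then show ?case using Suc.IH(2) B by linarith
  next
    case 2
    have "c n * v (Suc n) \<le> c n * ?B"
      using Suc.IH(2) c by (intro mult_left_mono)
    then show ?case using rec[of n] Suc.IH(1) B by linarith
  }
qed

text \<open>
  The weight \<open>g\<close> is \<open>b\<^sub>n\<^sub>-\<^sub>1\<close> in the log-convex and \<open>b\<^sub>n\<close> in the log-concave case. The last
  two inequalities say exactly that the numbers \<open>sqrt g\<^sub>n \<cdot> \<bar>P\<^sub>n(z)\<bar>\<close> satisfy a recurrence whose
  coefficients are at most \<open>(\<bar>z\<bar> + \<bar>a\<^sub>n\<bar>) / sqrt (b\<^sub>n b\<^sub>n\<^sub>-\<^sub>1)\<close> and \<open>1\<close>.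
\<close>

lemma shape_weight:
  fixes b :: "nat \<Rightarrow> real"
  assumes pos: "\<And>n. b n > 0" and "n\<^sub>0 \<ge> 1"
    and shape: "(\<forall>n\<ge>n\<^sub>0. (b n)\<^sup>2 \<le> b (n - 1) * b (n + 1)) \<or>
                (\<forall>n\<ge>n\<^sub>0. (b n)\<^sup>2 \<ge> b (n - 1) * b (n + 1))"
    and m: "m \<ge> n\<^sub>0" and inc: "\<And>n. n \<ge> m \<Longrightarrow> b n \<le> b (Suc n)"
  obtains g :: "nat \<Rightarrow> real" where "\<And>n. g n > 0" "\<And>n. n \<ge> m \<Longrightarrow> b n \<le> g (Suc n)"
    "\<And>n. n \<ge> m \<Longrightarrow> g (n + 2) * b n \<le> b (n + 1) * g (n + 1)"
    "\<And>n. n \<ge> m \<Longrightarrow> g (n + 2) * (b n)\<^sup>2 \<le> (b (n + 1))\<^sup>2 * g n"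
proof -
  note le = pos[THEN less_imp_le]
  from shape show ?thesis
  proof
    assume cvx: "\<forall>n\<ge>n\<^sub>0. (b n)\<^sup>2 \<le> b (n - 1) * b (n + 1)"
    have "b (n + 1) * (b n)\<^sup>2 \<le> (b (n + 1))\<^sup>2 * b (n - 1)" if "n \<ge> m" for n
      using mult_left_mono[OF cvx[rule_format, of n] le[of "n + 1"]] that m
      by (simp add: power2_eq_square algebra_simps)
    then show ?thesis
      by (intro that[of "\<lambda>n. b (n - 1)"]) (use pos in auto)
  next
    assume ccv: "\<forall>n\<ge>n\<^sub>0. (b n)\<^sup>2 \<ge> b (n - 1) * b (n + 1)"
    have *: "b (n + 2) * b n \<le> b (n + 1) * b (n + 1)" if "n \<ge> m" for n
      using ccv[rule_format, of "Suc n"] that m by (simp add: power2_eq_square mult.commute)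
    have "b (n + 2) * (b n)\<^sup>2 \<le> (b (n + 1))\<^sup>2 * b n" if "n \<ge> m" for n
      using mult_right_mono[OF *[OF that] le[of n]]
      by (simp add: power2_eq_square algebra_simps)
    then show ?thesis
      by (intro that[of b]) (use pos inc * in auto)
  qed
qed

text \<open>\<open>K\<close> is fixed before \<open>p\<close>, \<open>r\<close> and
  \<open>n\<close>, so the estimate is uniform in the point at which the polynomials are evaluated.
  The factor \<open>sqrt (b (n + m))\<close> on the left later makes the squares summable.\<close>

lemma weighted_recurrence_bound:
  fixes a b :: "nat \<Rightarrow> real"
  assumes pos: "\<And>n. b n > 0" and n0: "n\<^sub>0 \<ge> 1"
    and shape: "(\<forall>n\<ge>n\<^sub>0. (b n)\<^sup>2 \<le> b (n - 1) * b (n + 1)) \<or>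
                (\<forall>n\<ge>n\<^sub>0. (b n)\<^sup>2 \<ge> b (n - 1) * b (n + 1))"
    and m: "m \<ge> n\<^sub>0" and inc: "\<And>n. n \<ge> m \<Longrightarrow> b n \<le> b (Suc n)"
    and summ: "summable (\<lambda>n. \<bar>a (n + 1)\<bar> / sqrt (b (n + 1) * b n))"
  obtains K where "K > 0"
    "\<And>p r n. r \<ge> 0 \<Longrightarrow> (\<And>n. 0 \<le> p n) \<Longrightarrow>
       (\<And>n. b (n + 1) * p (n + 2) \<le> (r + \<bar>a (n + 1)\<bar>) * p (n + 1) + b n * p n) \<Longrightarrow>
       sqrt (b (n + m)) * p (Suc (n + m)) \<le> K * max (p m) (p (Suc m)) * (\<Prod>k<n. 1 + r / b (k + m))"
proof -
  obtain g :: "nat \<Rightarrow> real" where gpos: "\<And>n. g n > 0"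
    and gb: "\<And>n. n \<ge> m \<Longrightarrow> b n \<le> g (Suc n)"
    and g1: "\<And>n. n \<ge> m \<Longrightarrow> g (n + 2) * b n \<le> b (n + 1) * g (n + 1)"
    and g2: "\<And>n. n \<ge> m \<Longrightarrow> g (n + 2) * (b n)\<^sup>2 \<le> (b (n + 1))\<^sup>2 * g n"
    using shape_weight[OF pos n0 shape m inc] by metis
  define \<epsilon> where "\<epsilon> n = 1 / sqrt (b (n + 1) * b n)" for n
  have eps_nonneg: "\<epsilon> n \<ge> 0" for n
    using pos[of n] pos[of "n + 1"] by (simp add: \<epsilon>_def)
  \<comment> \<open>\<open>coeff1\<close> and \<open>coeff2\<close> treat the two coefficients that
    arise when the recurrence is divided by \<open>b (n + 1)\<close> and multiplied by
    \<open>sqrt (g (n + 2))\<close>.\<close>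
  have coeff1: "sqrt (g (n + 2)) / b (n + 1) \<le> \<epsilon> n * sqrt (g (n + 1))" if "n \<ge> m" for n
  proof -
    have "sqrt (g (n + 2)) * sqrt (b n) \<le> sqrt (b (n + 1)) * sqrt (g (n + 1))"
      using g1[OF that] by (simp flip: real_sqrt_mult)
    then have "sqrt (b (n + 1)) * (sqrt (g (n + 2)) * sqrt (b n)) \<le>
        sqrt (b (n + 1)) * (sqrt (b (n + 1)) * sqrt (g (n + 1)))"
      using pos[of "n + 1"] by (intro mult_left_mono) auto
    also have "\<dots> = b (n + 1) * sqrt (g (n + 1))"
      using pos[of "n + 1"] by (simp flip: mult.assoc)
    finally show ?thesis
      using pos[of n] pos[of "n + 1"] by (simp add: \<epsilon>_def real_sqrt_mult field_simps)
  qed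
  have coeff2: "sqrt (g (n + 2)) * b n / b (n + 1) \<le> sqrt (g n)" if "n \<ge> m" for n
  proof -
    have "sqrt (g (n + 2) * (b n)\<^sup>2) \<le> sqrt ((b (n + 1))\<^sup>2 * g n)"
      using g2[OF that] by simp
    then show ?thesis
      using pos[of n] pos[of "n + 1"] by (simp add: real_sqrt_mult field_simps)
  qed
  have eps_le: "\<epsilon> n \<le> 1 / b n" if "n \<ge> m" for n
  proof -
    have "sqrt (b n * b n) \<le> sqrt (b (n + 1) * b n)"
      using inc[OF that] pos[of n] by (intro real_sqrt_le_mono mult_right_mono) auto
    then have "b n \<le> sqrt (b (n + 1) * b n)" using pos[of n] by simp
    then show ?thesis
      unfolding \<epsilon>_def using pos[of n] pos[of "n + 1"] by (intro divide_left_mono) auto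
  qed
  define S where "S = (\<Sum>n. \<epsilon> (n + m) * \<bar>a (n + m + 1)\<bar>)"
  have summ': "summable (\<lambda>n. \<epsilon> (n + m) * \<bar>a (n + m + 1)\<bar>)"
    using summable_ignore_initial_segment[OF summ, of m] by (simp add: \<epsilon>_def)
  define G where "G = max (sqrt (g m)) (sqrt (g (Suc m)))"
  have Gpos: "G > 0"
    using gpos by (auto simp: G_def less_max_iff_disj)
  show ?thesis
  proof (rule that[of "G * exp S"])
    show "G * exp S > 0" using Gpos by simp
  next
    fix p :: "nat \<Rightarrow> real" and r :: real and n
    assume r: "r \<ge> 0" and p: "\<And>n. 0 \<le> p n"
      and rec: "\<And>n. b (n + 1) * p (n + 2) \<le> (r + \<bar>a (n + 1)\<bar>) * p (n + 1) + b n * p n"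
    define v where "v n = sqrt (g (n + m)) * p (n + m)" for n
    define c where "c n = \<epsilon> (n + m) * (r + \<bar>a (n + m + 1)\<bar>)" for n
    have v0: "v n \<ge> 0" for n
      using less_imp_le[OF gpos] p by (simp add: v_def)
    have c0: "c n \<ge> 0" for n
      using eps_nonneg r by (auto simp: c_def)
    have vrec: "v (Suc (Suc n)) \<le> c n * v (Suc n) + v n" for n
    proof -
      define k where "k = n + m"
      have k: "k \<ge> m" by (simp add: k_def)
      have "p (k + 2) \<le> ((r + \<bar>a (k + 1)\<bar>) * p (k + 1) + b k * p k) / b (k + 1)"
        using rec[of k] pos[of "k + 1"] by (simp add: field_simps)
      then have "sqrt (g (k + 2)) * p (k + 2) \<le>
          sqrt (g (k + 2)) * (((r + \<bar>a (k + 1)\<bar>) * p (k + 1) + b k * p k) / b (k + 1))"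
        using gpos[of "k + 2"] by (intro mult_left_mono) auto
      also have "\<dots> = (sqrt (g (k + 2)) / b (k + 1)) * ((r + \<bar>a (k + 1)\<bar>) * p (k + 1))
          + (sqrt (g (k + 2)) * b k / b (k + 1)) * p k"
        by (simp add: field_simps add_divide_distrib)
      also have "\<dots> \<le> (\<epsilon> k * sqrt (g (k + 1))) * ((r + \<bar>a (k + 1)\<bar>) * p (k + 1)) + sqrt (g k) * p k"
        using coeff1[OF k] coeff2[OF k] r p by (intro add_mono mult_right_mono) auto
      finally show ?thesis
        by (simp add: v_def c_def k_def algebra_simps)
    qed
    have "sqrt (b (n + m)) * p (Suc (n + m)) \<le> v (Suc n)"
      unfolding v_def using gb[of "n + m"] p by (auto intro!: mult_right_mono)
    also have "\<dots> \<le> max (v 0) (v 1) * (\<Prod>k<n. 1 + c k)"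
      by (rule two_step_recurrence_bound(2)[of v c, OF v0 c0 vrec])
    also have "\<dots> \<le> (G * max (p m) (p (Suc m))) * ((\<Prod>k<n. 1 + r / b (k + m)) * exp S)"
    proof (rule mult_mono)
      have "v 0 \<le> G * max (p m) (p (Suc m))" "v 1 \<le> G * max (p m) (p (Suc m))"
        unfolding v_def G_def using gpos[of m] gpos[of "Suc m"] p
        by (auto intro!: mult_mono simp: le_max_iff_disj less_imp_le)
      then show "max (v 0) (v 1) \<le> G * max (p m) (p (Suc m))" by simp
      show "0 \<le> G * max (p m) (p (Suc m))"
        using Gpos p by (simp add: le_max_iff_disj)
      show "0 \<le> (\<Prod>k<n. 1 + c k)"
        using c0 by (intro prod_nonneg) (auto intro: add_nonneg_nonneg)
      \<comment> \<open>Here \<open>r\<close> is decoupled from \<open>a\<close>: as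
        \<open>\<epsilon> k \<le> 1 / b k\<close> for \<open>k \<ge> m\<close>, each
        \<open>1 + c k\<close> is at most \<open>1 + r / b (k + m)\<close> times a factor free of
        \<open>r\<close>, and these factors multiply to at most \<open>exp S\<close>.\<close>
      have "(\<Prod>k<n. 1 + c k) \<le>
          (\<Prod>k<n. (1 + r / b (k + m)) * exp (\<epsilon> (k + m) * \<bar>a (k + m + 1)\<bar>))"
      proof (rule prod_mono, safe)
        fix k
        show "0 \<le> 1 + c k" using c0[of k] by simp
        let ?e = "\<epsilon> (k + m)" and ?a = "\<bar>a (k + m + 1)\<bar>"
        have "?e * r \<le> r / b (k + m)"
          using mult_right_mono[OF eps_le[of "k + m"] r] by simp
        moreover have "0 \<le> (r / b (k + m)) * (?e * ?a)"
          using eps_nonneg r pos[of "k + m"] by simp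
        moreover have "1 + c k = 1 + ?e * r + ?e * ?a"
          by (simp add: c_def distrib_left)
        moreover have "(1 + r / b (k + m)) * (1 + ?e * ?a) =
            1 + r / b (k + m) + ?e * ?a + (r / b (k + m)) * (?e * ?a)"
          by (simp only: distrib_left distrib_right mult_1 mult_1_right add.assoc)
        ultimately have "1 + c k \<le> (1 + r / b (k + m)) * (1 + ?e * ?a)"
          by linarith
        also have "\<dots> \<le> (1 + r / b (k + m)) * exp (?e * ?a)"
          using r pos[of "k + m"] by (intro mult_left_mono exp_ge_add_one_self) auto
        finally show "1 + c k \<le> (1 + r / b (k + m)) * exp (?e * ?a)" .
      qed
      also have "\<dots> = (\<Prod>k<n. 1 + r / b (k + m)) * exp (\<Sum>k<n. \<epsilon> (k + m) * \<bar>a (k + m + 1)\<bar>)"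
        by (simp add: prod.distrib exp_sum)
      also have "\<dots> \<le> (\<Prod>k<n. 1 + r / b (k + m)) * exp S"
      proof (rule mult_left_mono)
        show "exp (\<Sum>k<n. \<epsilon> (k + m) * \<bar>a (k + m + 1)\<bar>) \<le> exp S"
          unfolding S_def using eps_nonneg summ' by (auto intro!: sum_le_suminf)
        show "0 \<le> (\<Prod>k<n. 1 + r / b (k + m))"
          using r pos by (intro prod_nonneg) (auto intro!: add_nonneg_nonneg divide_nonneg_pos)
      qed
      finally show "(\<Prod>k<n. 1 + c k) \<le> (\<Prod>k<n. 1 + r / b (k + m)) * exp S" .
    qed
    finally show "sqrt (b (n + m)) * p (Suc (n + m)) \<le>
        (G * exp S) * max (p m) (p (Suc m)) * (\<Prod>k<n. 1 + r / b (k + m))"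
      by (simp add: mult_ac)
  qed
qed

text \<open>Serves for the finitely many initial polynomials from which the recurrence estimate
  starts; they cost only a polynomial factor in \<open>r\<close>. The base \<open>1 + r\<close>,
  being at least 1, permits one exponent for all degrees.\<close>

lemma polys_growth_bound:
  fixes Q :: "nat \<Rightarrow> complex poly"
  obtains A d where "A \<ge> 1"
    "\<And>n z r. n \<le> M \<Longrightarrow> norm z \<le> r \<Longrightarrow> norm (poly (Q n) z) \<le> A * (1 + r) ^ d"
proof -
  define d where "d = (\<Sum>n\<le>M. degree (Q n))"
  define A where "A = 1 + (\<Sum>n\<le>M. \<Sum>i\<le>degree (Q n). norm (coeff (Q n) i))"
  show ?thesis
  proof (rule that[of A d])
    show "A \<ge> 1" by (simp add: A_def sum_nonneg)
    fix n :: nat and z :: complex and r :: real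
    assume n: "n \<le> M" and z: "norm z \<le> r"
    have r: "r \<ge> 0" using z norm_ge_zero[of z] by linarith
    have deg: "degree (Q n) \<le> d"
      unfolding d_def using n by (intro member_le_sum) auto
    have "norm (poly (Q n) z) \<le> (\<Sum>i\<le>degree (Q n). norm (coeff (Q n) i) * norm z ^ i)"
      unfolding poly_altdef by (rule order_trans[OF norm_sum]) (simp add: norm_mult norm_power)
    also have "\<dots> \<le> (\<Sum>i\<le>degree (Q n). norm (coeff (Q n) i) * (1 + r) ^ d)"
    proof (intro sum_mono mult_left_mono)
      fix i assume "i \<in> {..degree (Q n)}"
      then have "i \<le> d" using deg by simp
      have "norm z ^ i \<le> (1 + r) ^ i" using z by (intro power_mono) auto
      also have "\<dots> \<le> (1 + r) ^ d" using r \<open>i \<le> d\<close> by (intro power_increasing) auto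
      finally show "norm z ^ i \<le> (1 + r) ^ d" .
    qed auto
    also have "\<dots> = (\<Sum>i\<le>degree (Q n). norm (coeff (Q n) i)) * (1 + r) ^ d"
      by (simp add: sum_distrib_right)
    also have "\<dots> \<le> A * (1 + r) ^ d"
    proof (rule mult_right_mono)
      have "(\<Sum>i\<le>degree (Q n). norm (coeff (Q n) i)) \<le>
          (\<Sum>n\<le>M. \<Sum>i\<le>degree (Q n). norm (coeff (Q n) i))"
        using n by (intro member_le_sum[of n "{..M}" "\<lambda>n. \<Sum>i\<le>degree (Q n). norm (coeff (Q n) i)"])
          (auto intro: sum_nonneg)
      then show "(\<Sum>i\<le>degree (Q n). norm (coeff (Q n) i)) \<le> A" by (simp add: A_def)
    qed (use r in auto)
    finally show "norm (poly (Q n) z) \<le> A * (1 + r) ^ d" .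
  qed
qed

section \<open>Bounds for the moment function on discs\<close>

lemma recurrence_eval:
  fixes z :: complex
  assumes "recurrence_coefficients P a b"
  defines "p \<equiv> \<lambda>n. norm (poly (map_poly complex_of_real (P n)) z)"
  shows "b (n + 1) * p (n + 2) \<le> (norm z + \<bar>a (n + 1)\<bar>) * p (n + 1) + b n * p n"
proof -
  let ?Q = "\<lambda>n. poly (map_poly complex_of_real (P n)) z"
  have bpos: "b k > 0" for k
    using assms by (simp add: recurrence_coefficients_def)
  \<comment> \<open>The recurrence is taken at index \<open>n + 1\<close>, where the boundary
    convention at 0 does not enter.\<close>
  have "pCons 0 (P (n + 1)) = smult (b (n + 1)) (P (n + 2)) + smult (a (n + 1)) (P (n + 1)) +
      smult (b n) (P n)"
    using assms unfolding recurrence_coefficients_def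
    by (auto dest: spec[of _ "Suc n"])
  then have "map_poly complex_of_real (pCons 0 (P (n + 1))) =
      smult (of_real (b (n + 1))) (map_poly complex_of_real (P (n + 2)))
      + smult (of_real (a (n + 1))) (map_poly complex_of_real (P (n + 1)))
      + smult (of_real (b n)) (map_poly complex_of_real (P n))"
    by (simp only:) (rule poly_eqI, simp add: coeff_map_poly)
  moreover have "map_poly complex_of_real (pCons 0 (P (n + 1))) =
      pCons 0 (map_poly complex_of_real (P (n + 1)))"
    by (rule poly_eqI) (simp add: coeff_map_poly coeff_pCons split: nat.split)
  ultimately have "z * ?Q (n + 1) = of_real (b (n + 1)) * ?Q (n + 2)
      + of_real (a (n + 1)) * ?Q (n + 1) + of_real (b n) * ?Q n"
    by (metis (no_types, lifting) poly_add poly_pCons poly_smult add_0)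
  then have "of_real (b (n + 1)) * ?Q (n + 2) =
      z * ?Q (n + 1) - of_real (a (n + 1)) * ?Q (n + 1) - of_real (b n) * ?Q n"
    by (simp add: algebra_simps)
  then have "norm (of_real (b (n + 1)) * ?Q (n + 2)) \<le>
      norm (z * ?Q (n + 1)) + norm (of_real (a (n + 1)) * ?Q (n + 1)) + norm (of_real (b n) * ?Q n)"
    by (metis (no_types, lifting) norm_triangle_ineq4 order_trans add_right_mono)
  then show ?thesis
    using bpos by (simp add: p_def norm_mult abs_of_pos algebra_simps)
qed

text \<open>The squares in the tail are at most a multiple of \<open>1 / b (n + m)\<close>, whose
  sum converges, and finitely many initial terms remain. This yields convergence of the series and
  the growth bound at once. The infinite product of the \<open>1 + r / b (n + m)\<close> is written
  as the exponential of a sum of logarithms.\<close>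

lemma moment_function_bound:
  assumes rc: "recurrence_coefficients P a b"
    and summ: "summable (\<lambda>n. (1 + \<bar>a (n + 1)\<bar>) / sqrt (b (n + 1) * b n))"
    and shape: "\<exists>n\<^sub>0\<ge>1. (\<forall>n\<ge>n\<^sub>0. (b n)\<^sup>2 \<le> b (n - 1) * b (n + 1)) \<or>
                         (\<forall>n\<ge>n\<^sub>0. (b n)\<^sup>2 \<ge> b (n - 1) * b (n + 1))"
  obtains A d m where "A > 0" "\<And>n. n \<ge> m \<Longrightarrow> b n \<le> b (Suc n)" "\<And>n. n \<ge> m \<Longrightarrow> b n > 1"
    "filterlim b at_top sequentially"
    "\<And>z. summable (\<lambda>n. (norm (poly (map_poly complex_of_real (P n)) z))\<^sup>2)"
    "\<And>z r. norm z \<le> r \<Longrightarrow>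
       moment_function P z \<le> A * (1 + r) ^ d * exp (\<Sum>n. ln (1 + r / b (n + m)))"
proof -
  have pos: "b n > 0" for n
    using rc by (simp add: recurrence_coefficients_def)
  have spos: "sqrt (b (n + 1) * b n) > 0" for n
    using pos by simp
  have summ_eps: "summable (\<lambda>n. 1 / sqrt (b (n + 1) * b n))"
    by (rule summable_comparison_test'[OF summ, of 0])
       (use spos in \<open>simp add: divide_right_mono less_imp_le\<close>)
  have summ_a: "summable (\<lambda>n. \<bar>a (n + 1)\<bar> / sqrt (b (n + 1) * b n))"
    by (rule summable_comparison_test'[OF summ, of 0])
       (use spos in \<open>simp add: divide_right_mono less_imp_le\<close>)
  obtain n\<^sub>0 where n0: "n\<^sub>0 \<ge> 1" and shape': "(\<forall>n\<ge>n\<^sub>0. (b n)\<^sup>2 \<le> b (n - 1) * b (n + 1)) \<or>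
                (\<forall>n\<ge>n\<^sub>0. (b n)\<^sup>2 \<ge> b (n - 1) * b (n + 1))"
    using shape by blast
  obtain m\<^sub>0 where m0: "m\<^sub>0 \<ge> n\<^sub>0" and inc0: "\<And>n. n \<ge> m\<^sub>0 \<Longrightarrow> b n \<le> b (Suc n)"
    using eventually_increasing[OF pos shape' summable_LIMSEQ_zero[OF summ_eps]] by metis
  \<comment> \<open>By monotonicity the geometric mean of \<open>b n\<close> and
    \<open>b (n + 1)\<close> is at most \<open>b (n + 1)\<close>, so \<open>summ_eps\<close>
    dominates.\<close>
  have summ_b: "summable (\<lambda>n. 1 / b n)"
  proof -
    have "1 / b (n + 1) \<le> 1 / sqrt (b (n + 1) * b n)" if "n \<ge> m\<^sub>0" for n
    proof (rule divide_left_mono)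
      have "sqrt (b (n + 1) * b n) \<le> sqrt (b (n + 1) * b (n + 1))"
        using inc0[OF that] pos[of "n + 1"] by (intro real_sqrt_le_mono mult_left_mono) auto
      then show "sqrt (b (n + 1) * b n) \<le> b (n + 1)" using pos[of "n + 1"] by simp
    qed (use pos in auto)
    then have "summable (\<lambda>n. 1 / b (n + 1))"
      by (intro summable_comparison_test'[OF summ_eps, of m\<^sub>0])
         (use pos in \<open>simp add: less_imp_le\<close>)
    then show ?thesis by (simp add: summable_Suc_iff[of "\<lambda>n. 1 / b n"])
  qed
  have b_top: "filterlim b at_top sequentially"
    using filterlim_inverse_at_top[OF summable_LIMSEQ_zero[OF summ_b]] pos by simp
  then obtain m\<^sub>1 where m1: "\<And>n. n \<ge> m\<^sub>1 \<Longrightarrow> b n > 1"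
    unfolding filterlim_at_top_dense eventually_sequentially by blast
  define m where "m = max m\<^sub>0 m\<^sub>1"
  have m: "m \<ge> n\<^sub>0" and inc: "\<And>n. n \<ge> m \<Longrightarrow> b n \<le> b (Suc n)"
    and b_gt_1: "\<And>n. n \<ge> m \<Longrightarrow> b n > 1"
    using m0 m1 inc0 by (auto simp: m_def)
  obtain K where K: "K > 0" and Kbound:
    "\<And>p r n. r \<ge> 0 \<Longrightarrow> (\<And>n. 0 \<le> p n) \<Longrightarrow>
       (\<And>n. b (n + 1) * p (n + 2) \<le> (r + \<bar>a (n + 1)\<bar>) * p (n + 1) + b n * p n) \<Longrightarrow>
       sqrt (b (n + m)) * p (Suc (n + m)) \<le> K * max (p m) (p (Suc m)) * (\<Prod>k<n. 1 + r / b (k + m))"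
    using weighted_recurrence_bound[OF pos n0 shape' m inc summ_a] by metis
  obtain A d where A: "A \<ge> 1" and Abound: "\<And>n z r. n \<le> Suc m \<Longrightarrow> norm z \<le> r \<Longrightarrow>
      norm (poly (map_poly complex_of_real (P n)) z) \<le> A * (1 + r) ^ d"
    using polys_growth_bound[of "Suc m" "\<lambda>n. map_poly complex_of_real (P n)"] by metis
  have summ_bm: "summable (\<lambda>n. 1 / b (n + m))"
    by (rule summable_ignore_initial_segment[OF summ_b])
  define S where "S = (\<Sum>n. 1 / b (n + m))"
  have summ_ln: "summable (\<lambda>n. ln (1 + r / b (n + m)))" if "r \<ge> 0" for r
  proof (rule summable_comparison_test'[OF summable_mult[OF summ_bm, of r], of 0])
    fix n
    have "r / b (n + m) \<ge> 0" using that pos[of "n + m"] by simp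
    then show "norm (ln (1 + r / b (n + m))) \<le> r * (1 / b (n + m))"
      using ln_add_one_self_le_self[of "r / b (n + m)"] by simp
  qed
  \<comment> \<open>In the constant, \<open>Suc m\<close> counts the initial terms, each at most
    \<open>(W * E)\<^sup>2\<close>, and \<open>K\<^sup>2 * S\<close> comes from the tail.\<close>
  have main: "summable (\<lambda>n. (norm (poly (map_poly complex_of_real (P n)) z))\<^sup>2)"
    "moment_function P z \<le> sqrt (Suc m + K\<^sup>2 * S) * A * (1 + r) ^ d * exp (\<Sum>n. ln (1 + r / b (n + m)))"
    if z: "norm z \<le> r" for z r
  proof -
    have r: "r \<ge> 0" using z norm_ge_zero[of z] by linarith
    define p where "p n = norm (poly (map_poly complex_of_real (P n)) z)" for n
    define E where "E = exp (\<Sum>n. ln (1 + r / b (n + m)))"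
    define W where "W = A * (1 + r) ^ d"
    have ln_nonneg: "0 \<le> ln (1 + r / b (n + m))" for n
      using r pos[of "n + m"] by simp
    have E: "E \<ge> 1" unfolding E_def
      using suminf_nonneg[OF summ_ln[OF r] ln_nonneg] by simp
    have W: "W \<ge> 0" using A r by (simp add: W_def)
    have p0: "p n \<ge> 0" for n by (simp add: p_def)
    have prod_le: "(\<Prod>k<n. 1 + r / b (k + m)) \<le> E" for n
    proof -
      have "(\<Prod>k<n. 1 + r / b (k + m)) = exp (\<Sum>k<n. ln (1 + r / b (k + m)))"
        unfolding exp_sum[OF finite_lessThan]
        by (intro prod.cong refl exp_ln[symmetric]) (use r pos in \<open>auto intro!: add_pos_nonneg divide_nonneg_pos\<close>)
      also have "\<dots> \<le> E"
        unfolding E_def using sum_le_suminf[OF summ_ln[OF r], of "{..<n}"] ln_nonneg by simp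
      finally show ?thesis .
    qed
    have rec: "b (n + 1) * p (n + 2) \<le> (r + \<bar>a (n + 1)\<bar>) * p (n + 1) + b n * p n" for n
    proof -
      have "b (n + 1) * p (n + 2) \<le> (norm z + \<bar>a (n + 1)\<bar>) * p (n + 1) + b n * p n"
        unfolding p_def by (rule recurrence_eval[OF rc])
      also have "\<dots> \<le> (r + \<bar>a (n + 1)\<bar>) * p (n + 1) + b n * p n"
        using z p0 by (intro add_right_mono mult_right_mono) auto
      finally show ?thesis .
    qed
    have tail: "(p (n + Suc m))\<^sup>2 \<le> (K * W * E)\<^sup>2 * (1 / b (n + m))" for n
    proof -
      have "sqrt (b (n + m)) * p (Suc (n + m)) \<le>
          K * max (p m) (p (Suc m)) * (\<Prod>k<n. 1 + r / b (k + m))"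
        by (rule Kbound[OF r p0 rec])
      also have "\<dots> \<le> K * W * E"
      proof (rule mult_mono)
        have "max (p m) (p (Suc m)) \<le> W"
          using Abound[OF _ z] by (simp add: p_def W_def)
        then show "K * max (p m) (p (Suc m)) \<le> K * W" using K by simp
        show "0 \<le> (\<Prod>k<n. 1 + r / b (k + m))"
          using r pos by (intro prod_nonneg) (auto intro!: add_nonneg_nonneg divide_nonneg_pos)
      qed (use prod_le K W in auto)
      finally have "(sqrt (b (n + m)) * p (Suc (n + m)))\<^sup>2 \<le> (K * W * E)\<^sup>2"
        using p0 pos[of "n + m"] by (intro power_mono) auto
      then show ?thesis
        using pos[of "n + m"] by (simp add: power_mult_distrib field_simps)
    qed
    have summ_tail: "summable (\<lambda>n. (p (n + Suc m))\<^sup>2)"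
      by (rule summable_comparison_test'[OF summable_mult[OF summ_bm, of "(K * W * E)\<^sup>2"], of 0])
         (use tail in simp)
    then show summ_p: "summable (\<lambda>n. (norm (poly (map_poly complex_of_real (P n)) z))\<^sup>2)"
      unfolding p_def by (subst (asm) summable_iff_shift)
    have "(\<Sum>n. (p n)\<^sup>2) = (\<Sum>n. (p (n + Suc m))\<^sup>2) + (\<Sum>n<Suc m. (p n)\<^sup>2)"
      using suminf_split_initial_segment summ_p unfolding p_def by blast
    also have "\<dots> \<le> (K * W * E)\<^sup>2 * S + Suc m * (W * E)\<^sup>2"
    proof (rule add_mono)
      show "(\<Sum>n. (p (n + Suc m))\<^sup>2) \<le> (K * W * E)\<^sup>2 * S"
        unfolding S_def suminf_mult[OF summ_bm, symmetric]
        by (rule suminf_le[OF tail summ_tail summable_mult[OF summ_bm]])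
      have "(p n)\<^sup>2 \<le> (W * E)\<^sup>2" if "n < Suc m" for n
      proof (rule power_mono)
        have "p n \<le> W" using Abound[OF _ z, of n] that by (simp add: p_def W_def)
        also have "\<dots> \<le> W * E" using W E by (simp add: mult_le_cancel_left1)
        finally show "p n \<le> W * E" .
      qed (rule p0)
      then show "(\<Sum>n<Suc m. (p n)\<^sup>2) \<le> Suc m * (W * E)\<^sup>2"
        using sum_mono[of "{..<Suc m}" "\<lambda>n. (p n)\<^sup>2" "\<lambda>_. (W * E)\<^sup>2"] by simp
    qed
    also have "\<dots> = (Suc m + K\<^sup>2 * S) * (W * E)\<^sup>2"
      by (simp add: power_mult_distrib algebra_simps)
    finally have "sqrt (\<Sum>n. (p n)\<^sup>2) \<le> sqrt ((Suc m + K\<^sup>2 * S) * (W * E)\<^sup>2)"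
      by simp
    also have "\<dots> = sqrt (Suc m + K\<^sup>2 * S) * (W * E)"
      using W E by (simp add: real_sqrt_mult)
    finally show "moment_function P z \<le>
        sqrt (Suc m + K\<^sup>2 * S) * A * (1 + r) ^ d * exp (\<Sum>n. ln (1 + r / b (n + m)))"
      by (simp add: moment_function_def p_def W_def E_def mult.assoc)
  qed
  have "S \<ge> 0"
    unfolding S_def using pos by (intro suminf_nonneg summ_bm) (simp add: less_imp_le)
  then have "sqrt (Suc m + K\<^sup>2 * S) * A > 0"
    using A by (intro mult_pos_pos) (auto intro!: add_pos_nonneg)
  from that[OF this inc b_gt_1 b_top main(1)[OF order_refl] main(2)] show ?thesis by blast
qed

subsection \<open>Lower bound\<close>

text \<open>The reflected polynomial has the value \<open>lead_coeff q\<close> at 0, and on the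
  circle of radius \<open>1 / r\<close> its modulus is that of \<open>q\<close> at the inverse point
  divided by \<open>r ^ degree q\<close>. Cauchy's inequality for the derivative of order 0 compares
  the two.\<close>

lemma lead_coeff_le_circle_max:
  fixes q :: "complex poly"
  assumes r: "r > 0" and B: "\<And>z. norm z = r \<Longrightarrow> norm (poly q z) \<le> B"
  shows "norm (lead_coeff q) * r ^ degree q \<le> B"
proof -
  have "norm ((deriv ^^ 0) (poly (reflect_poly q)) 0) \<le> fact 0 * (B / r ^ degree q) / (1 / r) ^ 0"
  proof (rule Cauchy_inequality)
    fix x :: complex assume "norm (0 - x) = 1 / r"
    then have x: "norm x = 1 / r" by simp
    then have "x \<noteq> 0" "norm (inverse x) = r" using r by (auto simp: norm_inverse)
    then show "norm (poly (reflect_poly q) x) \<le> B / r ^ degree q"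
      using B[of "inverse x"] r x
      by (simp add: poly_reflect_poly_nz norm_mult norm_power power_one_over divide_right_mono)
  qed (use r in \<open>auto intro!: holomorphic_intros continuous_intros\<close>)
  then show ?thesis using r by (simp add: field_simps)
qed

text \<open>At degree \<open>Suc n\<close> only the term with \<open>P (n + 1)\<close> survives on
  the right of the recurrence, so each step divides the leading coefficient by
  \<open>b n\<close>.\<close>

lemma lead_coeff_recurrence:
  assumes rc: "recurrence_coefficients P a b" and deg: "\<And>n. degree (P n) = n"
  shows "lead_coeff (P n) * (\<Prod>k<n. b k) = 1"
proof (induction n)
  case 0
  then show ?case using rc by (simp add: recurrence_coefficients_def)
next
  case (Suc n)
  have "pCons 0 (P n) = smult (b n) (P (n + 1)) + smult (a n) (P n) +
        (if n = 0 then 0 else smult (b (n - 1)) (P (n - 1)))"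
    using rc by (simp add: recurrence_coefficients_def)
  then have "coeff (pCons 0 (P n)) (Suc n) = coeff (smult (b n) (P (n + 1)) + smult (a n) (P n) +
        (if n = 0 then 0 else smult (b (n - 1)) (P (n - 1)))) (Suc n)"
    by simp
  moreover have "coeff (P n) (Suc n) = 0" "coeff (P (n - 1)) (Suc n) = 0"
    using deg by (auto intro!: coeff_eq_0)
  ultimately have "coeff (P n) n = b n * coeff (P (Suc n)) (Suc n)"
    by (auto split: if_splits)
  then show ?case using Suc deg by (simp add: mult_ac)
qed

text \<open>A single term of the series is at most the whole, so the moment function dominates every
  \<open>P n\<close> on the circle of radius \<open>r\<close>. The assumption \<open>bdd\<close>
  makes the supremum in \<open>max_modulus\<close> a genuine upper bound.\<close>

lemma power_le_max_modulus:
  assumes rc: "recurrence_coefficients P a b" and deg: "\<And>n. degree (P n) = n"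
    and summ: "\<And>z. summable (\<lambda>n. (norm (poly (map_poly complex_of_real (P n)) z))\<^sup>2)"
    and bdd: "bdd_above ((\<lambda>z. norm (moment_function P z)) ` cball 0 r)" and r: "r > 0"
  shows "r ^ n \<le> max_modulus (moment_function P) r * (\<Prod>k<n. b k)"
proof -
  let ?q = "map_poly complex_of_real (P n)"
  have bpos: "b k > 0" for k
    using rc by (simp add: recurrence_coefficients_def)
  have degq: "degree ?q = n"
    using deg by (simp add: degree_map_poly)
  have "norm (lead_coeff ?q) * r ^ degree ?q \<le> max_modulus (moment_function P) r"
  proof (rule lead_coeff_le_circle_max[OF r])
    fix z :: complex assume z: "norm z = r"
    have "sqrt ((norm (poly ?q z))\<^sup>2) \<le> moment_function P z"
      unfolding moment_function_def
      using sum_le_suminf[OF summ[of z], of "{n}"] by (intro real_sqrt_le_mono) simp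
    then have "norm (poly ?q z) \<le> norm (moment_function P z)" by simp
    also have "\<dots> \<le> max_modulus (moment_function P) r"
      unfolding max_modulus_def using z by (intro cSUP_upper bdd) simp
    finally show "norm (poly ?q z) \<le> max_modulus (moment_function P) r" .
  qed
  moreover have "norm (lead_coeff ?q) = \<bar>lead_coeff (P n)\<bar>"
    using degq deg by (simp add: coeff_map_poly)
  ultimately have "\<bar>lead_coeff (P n)\<bar> * r ^ n \<le> max_modulus (moment_function P) r"
    using degq by simp
  moreover have prod: "(\<Prod>k<n. b k) > 0" using bpos by (simp add: prod_pos)
  moreover have "lead_coeff (P n) = 1 / (\<Prod>k<n. b k)"
    using lead_coeff_recurrence[OF rc deg, of n] prod
    by (metis less_irrefl nonzero_eq_divide_eq)
  ultimately show ?thesis by (simp add: field_simps)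
qed

subsection \<open>Comparison with the logarithmic scale\<close>

text \<open>
  The sum is split at \<open>b\<^sub>n = r\<^sup>2\<close> rather than at \<open>b\<^sub>n = r\<close>: beyond \<open>r\<^sup>2\<close> the terms are at most
  \<open>1 / sqrt b\<^sub>n\<close>, which no longer depends on \<open>r\<close>.
\<close>

lemma suminf_ln_bound:
  fixes b :: "nat \<Rightarrow> real"
  assumes b: "\<And>n. b n > 1" and top: "filterlim b at_top sequentially"
    and summ: "summable (\<lambda>n. ln (b n) powr - \<alpha>)" and "\<alpha> > 0"
  obtains S T where "S \<ge> 0"
    "\<And>r. r > 1 \<Longrightarrow> (\<Sum>n. ln (1 + r / b n)) \<le> S * (2 * ln r) powr \<alpha> * ln (1 + r) + T"
proof -
  \<comment> \<open>Negative powers of \<open>b n\<close> decay faster than those of its logarithm;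
    the resulting sum becomes the constant \<open>T\<close>.\<close>
  have summ_sqrt: "summable (\<lambda>n. 1 / sqrt (b n))"
  proof (rule summable_comparison_test_ev[OF _ summ])
    have "eventually (\<lambda>x::real. 1 / sqrt x \<le> ln x powr - \<alpha>) at_top"
      using \<open>\<alpha> > 0\<close> by real_asymp
    then have "eventually (\<lambda>n. 1 / sqrt (b n) \<le> ln (b n) powr - \<alpha>) sequentially"
      using top by (rule eventually_compose_filterlim)
    then show "eventually (\<lambda>n. norm (1 / sqrt (b n)) \<le> ln (b n) powr - \<alpha>) sequentially"
    proof (rule eventually_mono)
      fix n assume "1 / sqrt (b n) \<le> ln (b n) powr - \<alpha>"
      then show "norm (1 / sqrt (b n)) \<le> ln (b n) powr - \<alpha>" using b[of n] by simp
    qed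
  qed
  show ?thesis
  proof (rule that)
    show "0 \<le> (\<Sum>n. ln (b n) powr - \<alpha>)" by (rule suminf_nonneg[OF summ]) simp
    fix r :: real assume r: "r > 1"
    let ?D = "(2 * ln r) powr \<alpha> * ln (1 + r)"
    have summ_rhs: "summable (\<lambda>n. ?D * ln (b n) powr - \<alpha> + 1 / sqrt (b n))"
      by (intro summable_add summable_mult summ summ_sqrt)
    \<comment> \<open>For \<open>b n \<le> r\<^sup>2\<close> the quantity
      \<open>(2 * ln r) powr \<alpha> * ln (b n) powr - \<alpha>\<close> is at least 1 and may be
      inserted as a weight, in the manner of Chebyshev's inequality.\<close>
    have term_le: "ln (1 + r / b n) \<le> ?D * ln (b n) powr - \<alpha> + 1 / sqrt (b n)" for n
    proof (cases "b n \<le> r\<^sup>2")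
      case True
      have bn: "b n > 1" by (rule b)
      have "ln (b n) \<le> ln (r\<^sup>2)"
        using True bn r by (subst ln_le_cancel_iff) auto
      also have "\<dots> = 2 * ln r" using r by (simp add: ln_realpow)
      finally have "(2 * ln r) powr - \<alpha> \<le> ln (b n) powr - \<alpha>"
        using bn \<open>\<alpha> > 0\<close> by (intro powr_mono2') auto
      then have "(2 * ln r) powr \<alpha> * (2 * ln r) powr - \<alpha> \<le> (2 * ln r) powr \<alpha> * ln (b n) powr - \<alpha>"
        by (rule mult_left_mono) simp
      then have one: "1 \<le> (2 * ln r) powr \<alpha> * ln (b n) powr - \<alpha>"
        using r by (simp flip: powr_add)
      have "r / b n \<le> r" using bn r by (simp add: field_simps)
      moreover have "0 < r / b n" using bn r by simp
      ultimately have "ln (1 + r / b n) \<le> ln (1 + r)" by simp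
      also have "\<dots> \<le> ln (1 + r) * ((2 * ln r) powr \<alpha> * ln (b n) powr - \<alpha>)"
        using mult_left_mono[OF one, of "ln (1 + r)"] r by simp
      also have "\<dots> \<le> ?D * ln (b n) powr - \<alpha> + 1 / sqrt (b n)"
        using bn by (simp add: mult_ac)
      finally show ?thesis .
    next
      case False
      have bn: "b n > 1" by (rule b)
      have "ln (1 + r / b n) \<le> r / b n"
        using r bn by (intro ln_add_one_self_le_self) auto
      also have "\<dots> \<le> sqrt (b n) / b n"
        using False r bn by (intro divide_right_mono real_le_rsqrt) auto
      also have "\<dots> = 1 / sqrt (b n)"
        using bn by (simp add: field_simps)
      also have "\<dots> \<le> ?D * ln (b n) powr - \<alpha> + 1 / sqrt (b n)"
        using r by simp
      finally show ?thesis .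
    qed
    have summ_l: "summable (\<lambda>n. ln (1 + r / b n))"
    proof (rule summable_comparison_test'[OF summ_rhs, of 0])
      fix n
      have "ln (1 + r / b n) \<ge> 0" using r b[of n] by simp
      then show "norm (ln (1 + r / b n)) \<le> ?D * ln (b n) powr - \<alpha> + 1 / sqrt (b n)"
        using term_le[of n] by simp
    qed
    have "(\<Sum>n. ln (1 + r / b n)) \<le> (\<Sum>n. ?D * ln (b n) powr - \<alpha> + 1 / sqrt (b n))"
      by (rule suminf_le[OF term_le summ_l summ_rhs])
    also have "\<dots> = ?D * (\<Sum>n. ln (b n) powr - \<alpha>) + (\<Sum>n. 1 / sqrt (b n))"
      by (simp add: suminf_add[symmetric] suminf_mult summ summ_sqrt summable_mult)
    finally show "(\<Sum>n. ln (1 + r / b n)) \<le>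
        (\<Sum>n. ln (b n) powr - \<alpha>) * (2 * ln r) powr \<alpha> * ln (1 + r) + (\<Sum>n. 1 / sqrt (b n))"
      by (simp add: mult_ac)
  qed
qed

text \<open>After taking logarithms the left side is at most a multiple of
  \<open>ln r powr (\<alpha> + 1)\<close> and the right side is
  \<open>ln r powr (\<beta> + 1)\<close>; the gap absorbs all constants and the power of
  \<open>1 + r\<close>.\<close>

lemma eventually_le_powr_ln_powr:
  fixes A S T \<alpha> \<beta> :: real and d :: nat
  assumes "A > 0" "S \<ge> 0" "0 < \<alpha>" "\<alpha> < \<beta>"
  shows "\<forall>\<^sub>F r in at_top. A * (1 + r) ^ d * exp (S * (2 * ln r) powr \<alpha> * ln (1 + r) + T) \<le>
           r powr (ln r powr \<beta>)"
proof -
  \<comment> \<open>Strictly positive majorants of the constants give every term a definite sign in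
    the asymptotic comparison.\<close>
  define C where "C = \<bar>ln A\<bar> + \<bar>T\<bar> + 1"
  define D where "D = real d + 1"
  define S' where "S' = S + 1"
  have pos: "C > 0" "D > 0" "S' > 0"
    using assms by (auto simp: C_def D_def S'_def add_nonneg_pos)
  have "\<forall>\<^sub>F r in at_top. C + D * ln (1 + r) + S' * (2 * ln r) powr \<alpha> * ln (1 + r) \<le>
      ln r powr \<beta> * ln r"
    using pos assms(3,4) by real_asymp
  then show ?thesis
    using eventually_gt_at_top[of 1]
  proof eventually_elim
    case (elim r)
    have "A * (1 + r) ^ d * exp (S * (2 * ln r) powr \<alpha> * ln (1 + r) + T) =
        exp (ln A + d * ln (1 + r) + (S * (2 * ln r) powr \<alpha> * ln (1 + r) + T))"
      using elim(2) assms(1) by (simp add: exp_add exp_of_nat_mult)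
    also have "\<dots> \<le> exp (C + D * ln (1 + r) + S' * (2 * ln r) powr \<alpha> * ln (1 + r))"
    proof -
      have "d * ln (1 + r) \<le> D * ln (1 + r)"
        using elim(2) by (simp add: D_def mult_right_mono)
      moreover have "S * ((2 * ln r) powr \<alpha> * ln (1 + r)) \<le> S' * ((2 * ln r) powr \<alpha> * ln (1 + r))"
        using elim(2) by (intro mult_right_mono) (auto simp: S'_def)
      ultimately show ?thesis by (simp add: C_def mult.assoc)
    qed
    also have "\<dots> \<le> r powr (ln r powr \<beta>)"
      using elim by (simp add: powr_def)
    finally show ?case .
  qed
qed

text \<open>Inverting the bound gives \<open>x n \<ge> (real n / C) powr (1 / \<alpha>)\<close>, so
  the terms are dominated by a multiple of \<open>real n powr - (\<beta> / \<alpha>)\<close>, whose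
  exponent is below -1.\<close>

lemma summable_powr_if_linear_bound:
  fixes x :: "nat \<Rightarrow> real"
  assumes bound: "\<forall>\<^sub>F n in sequentially. x n > 0 \<and> real n \<le> C * x n powr \<alpha>"
    and "C > 0" "0 < \<alpha>" "\<alpha> < \<beta>"
  shows "summable (\<lambda>n. x n powr - \<beta>)"
proof (rule summable_comparison_test_ev)
  show "summable (\<lambda>n. C powr (\<beta> / \<alpha>) * real n powr - (\<beta> / \<alpha>))"
    using assms by (intro summable_mult) (simp add: summable_real_powr_iff)
  show "\<forall>\<^sub>F n in sequentially. norm (x n powr - \<beta>) \<le> C powr (\<beta> / \<alpha>) * real n powr - (\<beta> / \<alpha>)"
    using bound eventually_gt_at_top[of 0]
  proof eventually_elim
    case (elim n)
    have "real n / C \<le> x n powr \<alpha>" using elim \<open>C > 0\<close> by (simp add: field_simps)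
    then have "(x n powr \<alpha>) powr - (\<beta> / \<alpha>) \<le> (real n / C) powr - (\<beta> / \<alpha>)"
      using elim assms by (intro powr_mono2') auto
    also have "(x n powr \<alpha>) powr - (\<beta> / \<alpha>) = x n powr - \<beta>"
      using assms by (simp add: powr_powr)
    also have "(real n / C) powr - (\<beta> / \<alpha>) = C powr (\<beta> / \<alpha>) * real n powr - (\<beta> / \<alpha>)"
      using assms by (simp add: powr_divide powr_minus field_simps)
    finally show ?case by simp
  qed
qed

text \<open>At \<open>r = (b n)\<^sup>2\<close> the left side of \<open>lower\<close> is
  \<open>b n ^ (2 * n)\<close>, while the product is at most a constant times
  \<open>b n ^ n\<close>; a full power \<open>b n ^ n\<close> is left to be bounded by
  \<open>M r\<close>. With \<open>r = b n\<close> it could cancel. Logarithms and division by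
  \<open>ln (b n)\<close> finish.\<close>

lemma index_le_ln_powr:
  fixes b :: "nat \<Rightarrow> real" and M :: "real \<Rightarrow> real"
  assumes pos: "\<And>n. b n > 0" and inc: "\<And>n. n \<ge> m \<Longrightarrow> b n \<le> b (Suc n)"
    and top: "filterlim b at_top sequentially" and "\<alpha> > 0"
    and lower: "\<And>r n. r > 0 \<Longrightarrow> r ^ n \<le> M r * (\<Prod>k<n. b k)"
    and upper: "\<forall>\<^sub>F r in at_top. M r \<le> r powr (ln r powr \<alpha>)"
  obtains C where "C > 0"
    "\<forall>\<^sub>F n in sequentially. ln (b n) > 0 \<and> real n \<le> C * ln (b n) powr \<alpha>"
proof -
  have mono: "b k \<le> b n" if "m \<le> k" "k \<le> n" for k n
    using that(2)
  proof (induction n rule: dec_induct)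
    case (step n)
    then show ?case using inc[of n] that(1) by simp
  qed simp
  define B where "B = (\<Sum>k<m. \<bar>ln (b k)\<bar>)"
  have B: "B \<ge> 0" by (simp add: B_def sum_nonneg)
  have "filterlim (\<lambda>n. (b n)\<^sup>2) at_top sequentially"
    by (intro filterlim_pow_at_top top) simp
  then have ev: "\<forall>\<^sub>F n in sequentially. M ((b n)\<^sup>2) \<le> (b n)\<^sup>2 powr (ln ((b n)\<^sup>2) powr \<alpha>)"
    using eventually_compose_filterlim[OF upper] by blast
  \<comment> \<open>The threshold \<open>exp 1\<close> makes \<open>x = ln (b n)\<close> exceed 1,
    so that \<open>B \<le> B * (x powr \<alpha> * x)\<close>.\<close>
  have ev_b: "\<forall>\<^sub>F n in sequentially. b n > exp 1"
    using top by (simp add: filterlim_at_top_dense)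
  have "\<forall>\<^sub>F n in sequentially. ln (b n) > 0 \<and> real n \<le> (B + 2 powr (\<alpha> + 1)) * ln (b n) powr \<alpha>"
    using ev ev_b eventually_ge_at_top[of m]
  proof eventually_elim
    case (elim n)
    define x where "x = ln (b n)"
    have "ln (exp 1) < ln (b n)" using elim(2) pos[of n] by (subst ln_less_cancel_iff) auto
    then have x: "x > 1" by (simp add: x_def)
    have ln_le: "ln (b k) \<le> (if k < m then \<bar>ln (b k)\<bar> else 0) + x" if "k < n" for k
    proof (cases "k < m")
      case True
      then show ?thesis using x by simp
    next
      case False
      then have "b k \<le> b n"
        using that by (intro mono) auto
      then show ?thesis using False pos by (simp add: x_def)
    qed
    have "(\<Sum>k<n. ln (b k)) \<le> (\<Sum>k<n. (if k < m then \<bar>ln (b k)\<bar> else 0) + x)"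
      by (intro sum_mono ln_le) simp
    also have "\<dots> = (\<Sum>k<n. if k < m then \<bar>ln (b k)\<bar> else 0) + n * x"
      by (simp add: sum.distrib)
    also have "(\<Sum>k<n. if k < m then \<bar>ln (b k)\<bar> else 0) = B"
      unfolding B_def using elim(3)
      by (intro sum.mono_neutral_cong_right) auto
    finally have sum_le: "(\<Sum>k<n. ln (b k)) \<le> B + n * x" .
    have prod: "(\<Prod>k<n. b k) > 0" using pos by (simp add: prod_pos)
    have "((b n)\<^sup>2) ^ n \<le> M ((b n)\<^sup>2) * (\<Prod>k<n. b k)"
      using pos[of n] by (intro lower) simp
    also have "\<dots> \<le> (b n)\<^sup>2 powr (ln ((b n)\<^sup>2) powr \<alpha>) * (\<Prod>k<n. b k)"
      using elim(1) prod by (intro mult_right_mono) auto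
    finally have "ln (((b n)\<^sup>2) ^ n) \<le> ln ((b n)\<^sup>2 powr (ln ((b n)\<^sup>2) powr \<alpha>) * (\<Prod>k<n. b k))"
      using pos[of n] prod by (subst ln_le_cancel_iff) (auto intro!: mult_pos_pos)
    also have "\<dots> = ln ((b n)\<^sup>2) powr \<alpha> * ln ((b n)\<^sup>2) + (\<Sum>k<n. ln (b k))"
      using pos prod by (subst ln_mult_pos) (auto simp: ln_powr ln_prod less_imp_neq[symmetric])
    also have "ln ((b n)\<^sup>2) = 2 * x"
      using pos[of n] by (simp add: ln_realpow x_def)
    also have "ln (((b n)\<^sup>2) ^ n) = n * (2 * x)"
      using pos[of n] by (simp add: ln_realpow x_def)
    finally have "n * x \<le> B + (2 * x) powr \<alpha> * (2 * x)"
      using sum_le by (simp add: algebra_simps)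
    also have "(2 * x) powr \<alpha> * (2 * x) = 2 powr (\<alpha> + 1) * x powr \<alpha> * x"
      using x by (simp add: powr_mult powr_add)
    also have "B \<le> B * (x powr \<alpha> * x)"
    proof -
      have "1 \<le> x powr \<alpha>" using x \<open>\<alpha> > 0\<close> by (simp add: ge_one_powr_ge_zero)
      then have "1 * 1 \<le> x powr \<alpha> * x" using x by (intro mult_mono) auto
      then show ?thesis using mult_left_mono[OF _ B, of 1] by simp
    qed
    finally have "n * x \<le> ((B + 2 powr (\<alpha> + 1)) * x powr \<alpha>) * x"
      by (simp add: algebra_simps)
    then show ?case using x by (simp add: x_def)
  qed
  then show ?thesis using B by (intro that) (auto intro: add_nonneg_pos)
qed

text \<open>Each half of the comparison loses an arbitrarily small amount in the exponent, to which
  the infima are blind. An empty set on the right gives infinity.\<close>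

lemma Inf_ereal_le_Inf_ereal:
  fixes Q R :: "real \<Rightarrow> bool"
  assumes "\<And>\<alpha> \<beta>. \<alpha> > 0 \<Longrightarrow> Q \<alpha> \<Longrightarrow> \<alpha> < \<beta> \<Longrightarrow> R \<beta>"
  shows "Inf {ereal \<beta> |\<beta>. \<beta> > 0 \<and> R \<beta>} \<le> Inf {ereal \<alpha> |\<alpha>. \<alpha> > 0 \<and> Q \<alpha>}"
proof (rule Inf_greatest, safe, rule ereal_le_epsilon2)
  fix \<alpha> e :: real assume "\<alpha> > 0" "Q \<alpha>" and "e > 0"
  then have "R (\<alpha> + e)" using assms[of \<alpha> "\<alpha> + e"] by simp
  then show "Inf {ereal \<beta> |\<beta>. \<beta> > 0 \<and> R \<beta>} \<le> ereal \<alpha> + ereal e"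
    using \<open>\<alpha> > 0\<close> \<open>e > 0\<close> by (intro Inf_lower) auto
qed

section \<open>Equality of the logarithmic order and the exponent of convergence\<close>

theorem theorem5p12:
  fixes s :: "nat \<Rightarrow> real" and \<mu> :: "real measure"
    and P :: "nat \<Rightarrow> real poly" and a b :: "nat \<Rightarrow> real"
  assumes "solves_moment_problem s \<mu>"
    and "orthonormal_polynomials \<mu> P"
    and "recurrence_coefficients P a b"
    and "summable (\<lambda>n. (1 + \<bar>a (n + 1)\<bar>) / sqrt (b (n + 1) * b n))"
    and "\<exists>n\<^sub>0\<ge>1. (\<forall>n\<ge>n\<^sub>0. (b n)\<^sup>2 \<le> b (n - 1) * b (n + 1)) \<or>
                  (\<forall>n\<ge>n\<^sub>0. (b n)\<^sup>2 \<ge> b (n - 1) * b (n + 1))"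
    and "growth_order (moment_function P) = 0"
  shows "logarithmic_order (moment_function P) = exponent_of_convergence (\<lambda>n. ln (b n))"
proof -
  have pos: "b n > 0" for n
    using assms(3) by (simp add: recurrence_coefficients_def)
  have deg: "degree (P n) = n" for n
    using assms(2) by (simp add: orthonormal_polynomials_def)
  obtain A d m where A: "A > 0" and inc: "\<And>n. n \<ge> m \<Longrightarrow> b n \<le> b (Suc n)"
    and b_gt_1: "\<And>n. n \<ge> m \<Longrightarrow> b n > 1" and top: "filterlim b at_top sequentially"
    and summ: "\<And>z. summable (\<lambda>n. (norm (poly (map_poly complex_of_real (P n)) z))\<^sup>2)"
    and bound: "\<And>z r. norm z \<le> r \<Longrightarrow>
       moment_function P z \<le> A * (1 + r) ^ d * exp (\<Sum>n. ln (1 + r / b (n + m)))"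
    using moment_function_bound[OF assms(3-5)] by metis
  have nonneg: "moment_function P z \<ge> 0" for z
    unfolding moment_function_def by (intro real_sqrt_ge_zero suminf_nonneg summ) simp
  have bdd: "bdd_above ((\<lambda>z. norm (moment_function P z)) ` cball 0 r)" for r
    using bound nonneg by (intro bdd_aboveI2) auto
  have le: "max_modulus (moment_function P) r \<le> A * (1 + r) ^ d * exp (\<Sum>n. ln (1 + r / b (n + m)))"
    if "r \<ge> 0" for r
    unfolding max_modulus_def using bound nonneg that by (intro cSUP_least) auto
  show ?thesis
    unfolding logarithmic_order_def exponent_of_convergence_def
  proof (rule antisym; rule Inf_ereal_le_Inf_ereal)
    \<comment> \<open>First inequality: convergence at \<alpha> gives the growth bound at every
      \<beta> > \<alpha>.\<close>
    fix \<alpha> \<beta> :: real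
    assume \<alpha>: "\<alpha> > 0" "\<alpha> < \<beta>"
      and "\<exists>N. (\<forall>n\<ge>N. norm (ln (b n)) > 0) \<and> summable (\<lambda>n. norm (ln (b (n + N))) powr - \<alpha>)"
    then obtain N where "summable (\<lambda>n. norm (ln (b (n + N))) powr - \<alpha>)"
      by blast
    then have "summable (\<lambda>n. norm (ln (b n)) powr - \<alpha>)"
      by (subst (asm) summable_iff_shift)
    then have "summable (\<lambda>n. norm (ln (b (n + m))) powr - \<alpha>)"
      by (rule summable_ignore_initial_segment)
    then have "summable (\<lambda>n. ln (b (n + m)) powr - \<alpha>)"
      using b_gt_1 by (simp add: less_imp_le)
    moreover have "filterlim (\<lambda>n. b (n + m)) at_top sequentially"
      using top by (rule filterlim_compose) (rule filterlim_add_const_nat_at_top)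
    ultimately obtain S T where S: "S \<ge> 0" and T: "\<And>r. r > 1 \<Longrightarrow>
        (\<Sum>n. ln (1 + r / b (n + m))) \<le> S * (2 * ln r) powr \<alpha> * ln (1 + r) + T"
      using suminf_ln_bound[of "\<lambda>n. b (n + m)" \<alpha>] b_gt_1 \<alpha>(1) by (metis le_add2)
    show "\<forall>\<^sub>F r in at_top. max_modulus (moment_function P) r \<le> r powr (ln r powr \<beta>)"
      using eventually_le_powr_ln_powr[OF A S \<alpha>, of d T] eventually_gt_at_top[of 1]
    proof eventually_elim
      case (elim r)
      have "max_modulus (moment_function P) r \<le> A * (1 + r) ^ d * exp (\<Sum>n. ln (1 + r / b (n + m)))"
        using elim(2) by (intro le) simp
      also have "\<dots> \<le> A * (1 + r) ^ d * exp (S * (2 * ln r) powr \<alpha> * ln (1 + r) + T)"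
        using T[OF elim(2)] A elim(2) by (intro mult_left_mono) auto
      also note elim(1)
      finally show ?case .
    qed
  next
    \<comment> \<open>Converse inequality: the growth bound at \<alpha> forces \<open>n\<close> to
      be at most a multiple of \<open>ln (b n) powr \<alpha>\<close>, hence convergence at every
      \<beta> > \<alpha>.\<close>
    fix \<alpha> \<beta> :: real
    assume \<alpha>: "\<alpha> > 0" "\<alpha> < \<beta>"
      and upper: "\<forall>\<^sub>F r in at_top. max_modulus (moment_function P) r \<le> r powr (ln r powr \<alpha>)"
    obtain C where C: "C > 0"
      "\<forall>\<^sub>F n in sequentially. ln (b n) > 0 \<and> real n \<le> C * ln (b n) powr \<alpha>"
      using index_le_ln_powr[OF pos inc top \<alpha>(1) power_le_max_modulus[OF assms(3) deg summ bdd] upper]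
      by blast
    have "summable (\<lambda>n. ln (b n) powr - \<beta>)"
      by (rule summable_powr_if_linear_bound[OF C(2,1) \<alpha>])
    then have "summable (\<lambda>n. ln (b (n + m)) powr - \<beta>)"
      by (rule summable_ignore_initial_segment)
    then have "summable (\<lambda>n. norm (ln (b (n + m))) powr - \<beta>)"
      using b_gt_1 by (simp add: less_imp_le)
    then show "\<exists>N. (\<forall>n\<ge>N. norm (ln (b n)) > 0) \<and> summable (\<lambda>n. norm (ln (b (n + N))) powr - \<beta>)"
      using b_gt_1 by (intro exI[of _ m]) force
  qed
qed

end
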